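(* Let $n\ge 1$ and let $\mathbf{a}=\{a_{ij}>0: 1\le i\le j\le n+1\}$ be any vector of positive parameters. Let $\mathrm{LAss}_n^{\rm III}(\mathbf{a})$ be the face lattice of $\mathrm{Ass}_n^{\rm III}(\mathbf{a})$ and let $\mathrm{LAss}_n$ be the lattice of subdivisions of a convex $(n+3)$-gon ordered by refinement. Then the correspondence $$\varphi:\ \mathrm{LAss}_n^{\rm III}(\mathbf{a})\longrightarrow \mathrm{LAss}_n,\qquad F_w\longmapsto S_w,$$ where $w$ ranges over linear functions $w\in(\mathbb{R}^{n+1})^*$, defines an order-preserving bijection. In particular, $\mathrm{Ass}_n^{\rm III}(\mathbf{a})$ is an associahedron.
   Context: For $1\le i\le j\le n+1$ let $\Delta_{[i,\dots,j]}=\mathrm{conv}\{e_i,e_{i+1},\dots,e_j\}\subset\mathbb{R}^{n+1}$, and define the Minkowski sum $$\mathrm{Ass}_n^{\rm III}(\mathbf{a})=\sum_{1\le i\le j\le n+1}a_{ij}\,\Delta_{[i,\dots,j]}\subset\mathbb{R}^{n+1}.$$ For a linear function $w=(w_1,\dots,w_{n+1})\in(\mathbb{R}^{n+1})^*$, let $F_w$ be the face of $\mathrm{Ass}_n^{\rm III}(\mathbf{a})$ consisting of the points maximizing $w$ (these are exactly the nonempty faces). Fix a convex $(n+3)$-gon with vertices labeled counterclockwise $0,1,\dots,n+2$. Put $w_0=w_{n+2}=\infty$ and, for $k=0,\dots,n+2$, let $H_k=\mathrm{conv}\{i\in\{0,\dots,n+2\}: w_i\ge w_k\}$ (convex hull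 of the corresponding vertices). $S_w$ is the subdivision of the $(n+3)$-gon obtained as the common refinement of the subdivisions induced by the polygons $H_k$, $k=0,\dots,n+2$; that is, its set of diagonals is the set of all edges of the $H_k$ that are diagonals of the $(n+3)$-gon. Subdivisions of the $(n+3)$-gon are polyhedral subdivisions without new vertices, i.e. sets of pairwise non-crossing diagonals; they are ordered by refinement, with the finer subdivision smaller. Faces are ordered by inclusion. As usual, when speaking of lattices, the empty face corresponds to a formal minimum element adjoined to the poset of subdivisions. An associahedron $\mathrm{Ass}_n$ is an $n$-dimensional simple polytope whose face lattice is isomorphic to the lattice of subdivisions of a convex $(n+3)$-gon ordered by refinement. *)

theory Defs
  imports "HOL-Analysis.Analysis"
begin

text \<open>
  Coordinates of \<open>real ^ 'd\<close> are labelled \<open>1, \<dots>, n + 1\<close> by a bijection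
  \<open>idx\<close> from \<open>{1..n + 1}\<close> onto \<open>'d\<close>, so that \<open>real ^ 'd\<close> is the space of dimension \<open>n + 1\<close>
  and \<open>axis (idx k) 1\<close> is the basis vector with label \<open>k\<close>.
\<close>

definition interval_simplex :: "(nat \<Rightarrow> 'd::finite) \<Rightarrow> nat \<Rightarrow> nat \<Rightarrow> (real ^ 'd) set" where
  "interval_simplex idx i j = convex hull ((\<lambda>k. axis (idx k) 1) ` {i..j})"

text \<open>The sum below is the Minkowski sum, as \<open>+\<close> on sets is elementwise.\<close>

definition Ass_III ::
    "(nat \<Rightarrow> 'd::finite) \<Rightarrow> nat \<Rightarrow> (nat \<Rightarrow> nat \<Rightarrow> real) \<Rightarrow> (real ^ 'd) set" where
  "Ass_III idx n a =
     (\<Sum>(i, j) \<in> {(i, j). 1 \<le> i \<and> i \<le> j \<and> j \<le> n + 1}.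
        (\<lambda>x. a i j *\<^sub>R x) ` interval_simplex idx i j)"

text \<open>The linear function \<open>w\<close> is given by its coefficient vector.\<close>

definition max_face :: "(real ^ 'd) set \<Rightarrow> real ^ 'd \<Rightarrow> (real ^ 'd) set" where
  "max_face P w = {x \<in> P. \<forall>y \<in> P. w \<bullet> y \<le> w \<bullet> x}"

text \<open>
  The points \<open>p 0, \<dots>, p (n + 2)\<close> are the vertices of a (strictly) convex polygon, labelled
  counterclockwise: every triple with increasing labels is positively oriented.
\<close>

definition convex_gon :: "nat \<Rightarrow> (nat \<Rightarrow> real ^ 2) \<Rightarrow> bool" where
  "convex_gon n p \<longleftrightarrow>
     (\<forall>i j k. i < j \<and> j < k \<and> k \<le> n + 2 \<longrightarrow>
        (p j $ 1 - p i $ 1) * (p k $ 2 - p i $ 2)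
          - (p j $ 2 - p i $ 2) * (p k $ 1 - p i $ 1) > 0)"

definition diagonals :: "nat \<Rightarrow> (nat \<Rightarrow> real ^ 2) \<Rightarrow> (real ^ 2) set set" where
  "diagonals n p =
     {closed_segment (p i) (p j) |i j. i + 1 < j \<and> j \<le> n + 2 \<and> (i, j) \<noteq> (0, n + 2)}"

text \<open>A subdivision is encoded by its set of diagonals; diagonals may share an endpoint.\<close>

definition subdivisions :: "nat \<Rightarrow> (nat \<Rightarrow> real ^ 2) \<Rightarrow> (real ^ 2) set set set" where
  "subdivisions n p =
     {S. S \<subseteq> diagonals n p \<and> pairwise (\<lambda>D E. disjnt (rel_interior D) (rel_interior E)) S}"

text \<open>\<open>None\<close> is the formal minimum; a finer subdivision, having more diagonals, is smaller.\<close>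

definition LAss :: "nat \<Rightarrow> (nat \<Rightarrow> real ^ 2) \<Rightarrow> (real ^ 2) set set option set" where
  "LAss n p = insert None (Some ` subdivisions n p)"

fun LAss_le :: "'a set option \<Rightarrow> 'a set option \<Rightarrow> bool" where
  "LAss_le None _ \<longleftrightarrow> True"
| "LAss_le (Some S) None \<longleftrightarrow> False"
| "LAss_le (Some S) (Some T) \<longleftrightarrow> T \<subseteq> S"

definition weight :: "(nat \<Rightarrow> 'd::finite) \<Rightarrow> nat \<Rightarrow> real ^ 'd \<Rightarrow> nat \<Rightarrow> ereal" where
  "weight idx n w k = (if 1 \<le> k \<and> k \<le> n + 1 then ereal (w $ idx k) else \<infinity>)"

definition upper_hull ::
    "(nat \<Rightarrow> 'd::finite) \<Rightarrow> nat \<Rightarrow> (nat \<Rightarrow> real ^ 2) \<Rightarrow> real ^ 'd \<Rightarrow> nat \<Rightarrow> (real ^ 2) set" where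
  "upper_hull idx n p w k =
     convex hull (p ` {i. i \<le> n + 2 \<and> weight idx n w i \<ge> weight idx n w k})"

definition subdiv_of ::
    "(nat \<Rightarrow> 'd::finite) \<Rightarrow> nat \<Rightarrow> (nat \<Rightarrow> real ^ 2) \<Rightarrow> real ^ 'd \<Rightarrow> (real ^ 2) set set" where
  "subdiv_of idx n p w =
     {D \<in> diagonals n p. \<exists>k \<le> n + 2. D edge_of upper_hull idx n p w k}"

text \<open>The face lattice, ordered by inclusion; it contains \<open>{}\<close> and \<open>P\<close>.\<close>

definition faces :: "'a::real_vector set \<Rightarrow> 'a set set" where
  "faces P = {F. F face_of P}"

definition poset_iso ::
    "('a \<Rightarrow> 'b) \<Rightarrow> 'a set \<Rightarrow> ('a \<Rightarrow> 'a \<Rightarrow> bool) \<Rightarrow> 'b set \<Rightarrow> ('b \<Rightarrow> 'b \<Rightarrow> bool) \<Rightarrow> bool" where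
  "poset_iso f A leA B leB \<longleftrightarrow>
     bij_betw f A B \<and> (\<forall>x \<in> A. \<forall>y \<in> A. leA x y \<longleftrightarrow> leB (f x) (f y))"

definition simple_polytope :: "'a::euclidean_space set \<Rightarrow> bool" where
  "simple_polytope P \<longleftrightarrow>
     polytope P \<and>
     (\<forall>v. v extreme_point_of P \<longrightarrow> int (card {F. F facet_of P \<and> v \<in> F}) = aff_dim P)"

definition associahedron :: "nat \<Rightarrow> 'a::euclidean_space set \<Rightarrow> bool" where
  "associahedron n P \<longleftrightarrow>
     simple_polytope P \<and> aff_dim P = int n \<and>
     (\<exists>p f. convex_gon n p \<and> poset_iso f (faces P) (\<subseteq>) (LAss n p) LAss_le)"

text \<open>Convex polygons exist for every \<open>n\<close>: take points on a parabola.\<close>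

lemma convex_gon_exists: "convex_gon n (\<lambda>k. vector [real k, (real k)\<^sup>2])"
proof -
  have "(real j - real i) * ((real k)\<^sup>2 - (real i)\<^sup>2)
          - ((real j)\<^sup>2 - (real i)\<^sup>2) * (real k - real i) > 0" if "i < j" "j < k" for i j k :: nat
  proof -
    have "(real j - real i) * ((real k)\<^sup>2 - (real i)\<^sup>2)
          - ((real j)\<^sup>2 - (real i)\<^sup>2) * (real k - real i)
          = (real j - real i) * (real k - real i) * (real k - real j)"
      by (simp add: power2_eq_square algebra_simps)
    with that show ?thesis by simp
  qed
  then show ?thesis by (simp add: convex_gon_def)
qed

end

theory Submission
  imports Defs
begin

text \<open>
  A linear function \<open>w\<close> is read as a height \<open>weight idx n w\<close> on the vertices \<open>0, \<dots>, n + 2\<close> of the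
  polygon, with infinitely high walls at both ends. Both sides of the correspondence are
  expressed through these heights.

  On the polytope side, the face of a Minkowski sum maximizing \<open>w\<close> is the sum of the faces of the
  summands maximizing \<open>w\<close>. The face of the summand of an interval is spanned by the highest
  positions of that interval, so the face \<open>F_w\<close> lies in \<open>F_v\<close> iff on every interval the highest
  positions for \<open>w\<close> are among those for \<open>v\<close>.

  On the polygon side, a diagonal between \<open>i\<close> and \<open>j\<close> is an edge of some upper hull iff \<open>i\<close> and \<open>j\<close>
  \<^emph>\<open>see\<close> each other: everything strictly between is lower than both. So \<open>S_w\<close> is the set of these
  sight lines, and two sight lines cannot cross.

  The lemma \<open>sightlines_subset_iff\<close> joins the two sides: \<open>F_w\<close> lies in \<open>F_v\<close> iff \<open>S_v\<close> is
  contained in \<open>S_w\<close>. It rests on the pair of nearest higher positions to the left and to the right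
  of a position, which is a sight line unless it consists of the two walls. This equivalence makes \<open>F_w \<mapsto> S_w\<close> well
  defined, injective and monotone in both directions at once. Surjectivity is an explicit
  inverse (\<open>sightlines_depth\<close>): given a set \<open>T\<close> of pairwise non-crossing diagonals, let the height of
  \<open>k\<close> be minus the number of diagonals in \<open>T\<close> that separate \<open>k\<close> from the side joining \<open>0\<close> and \<open>n + 2\<close>.

  Simplicity follows from the isomorphism. Facets are the maximal proper faces, hence correspond to
  single diagonals, and the facets through the vertex \<open>F_w\<close> correspond to the elements of \<open>S_w\<close>. At
  a vertex every interval has a unique highest position; sending a sight line to the highest
  position strictly below it is then a bijection from \<open>S_w\<close>, together with the pair \<open>(0, n + 2)\<close>, onto
  \<open>{1..n + 1}\<close> (\<open>card_sightlines\<close>). So \<open>S_w\<close> has \<open>n\<close> elements, and \<open>n\<close> is also the dimension.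
\<close>

section \<open>Diagonals of a convex polygon\<close>

text \<open>
  Twice the signed area of the triangle \<open>a b c\<close>. Along a chord of the polygon its sign tells on which
  side a vertex lies, which turns the geometry into comparisons of labels.
\<close>

definition orient :: "real ^ 2 \<Rightarrow> real ^ 2 \<Rightarrow> real ^ 2 \<Rightarrow> real" where
  "orient a b c = (b $ 1 - a $ 1) * (c $ 2 - a $ 2) - (b $ 2 - a $ 2) * (c $ 1 - a $ 1)"

lemma orient_degenerate [simp]: "orient a b a = 0" "orient a b b = 0" "orient a a b = 0"
  by (auto simp: orient_def)

lemma orient_swap: "orient a c b = - orient a b c"
  by (simp add: orient_def algebra_simps)

lemma orient_rotate: "orient b c a = orient a b c"
  by (simp add: orient_def algebra_simps)

lemma orient_affine:
  assumes "u + v = 1"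
  shows "orient a b (u *\<^sub>R x + v *\<^sub>R y) = u * orient a b x + v * orient a b y"
proof -
  have "v = 1 - u" using assms by simp
  show ?thesis unfolding \<open>v = 1 - u\<close> by (simp add: orient_def algebra_simps)
qed

lemma convex_gon_orient:
  assumes "convex_gon n p" "i < j" "j < k" "k \<le> n + 2"
  shows "orient (p i) (p j) (p k) > 0"
  using assms unfolding convex_gon_def orient_def by blast

lemma orient_pos_outside:
  assumes "convex_gon n p" "i < j" "j \<le> n + 2" "k \<le> n + 2" "k < i \<or> j < k"
  shows "orient (p i) (p j) (p k) > 0"
  using assms convex_gon_orient[of n p i j k] convex_gon_orient[of n p k i j]
  by (auto simp: orient_rotate)

lemma orient_neg_inside:
  assumes "convex_gon n p" "i < k" "k < j" "j \<le> n + 2"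
  shows "orient (p i) (p j) (p k) < 0"
  using assms convex_gon_orient[of n p i k j] by (simp add: orient_swap[of _ "p j"])

lemma convex_gon_inj:
  assumes gon: "convex_gon n p"
  shows "inj_on p {..n + 2}"
proof -
  have *: "p i \<noteq> p j" if ij: "i < j" "j \<le> n + 2" for i j
  proof
    assume eq: "p i = p j"
    consider "0 < i" | "i = 0" "j < n + 2" | "i = 0" "j = n + 2"
      using ij by linarith
    then show False
    proof cases
      case 1 then show ?thesis
        using orient_pos_outside[OF gon ij, of 0] eq by simp
    next
      case 2 then show ?thesis
        using orient_pos_outside[OF gon ij, of "n + 2"] eq by simp
    next
      case 3 then show ?thesis
        using orient_neg_inside[OF gon, of 0 1 j] eq by simp
    qed
  qed
  show ?thesis
    by (rule linorder_inj_onI) (use * in auto)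
qed

text \<open>
  Diagonals are handled as pairs of labels; \<open>chord_segment\<close> translates them back into segments of
  the plane.
\<close>

definition chords :: "nat \<Rightarrow> (nat \<times> nat) set" where
  "chords n = {(i, j). i + 1 < j \<and> j \<le> n + 2 \<and> (i, j) \<noteq> (0, n + 2)}"

definition chord_segment :: "(nat \<Rightarrow> real ^ 2) \<Rightarrow> nat \<times> nat \<Rightarrow> (real ^ 2) set" where
  "chord_segment p c = closed_segment (p (fst c)) (p (snd c))"

definition crossing :: "nat \<times> nat \<Rightarrow> nat \<times> nat \<Rightarrow> bool" where
  "crossing c d \<longleftrightarrow>
     fst c < fst d \<and> fst d < snd c \<and> snd c < snd d \<or>
     fst d < fst c \<and> fst c < snd d \<and> snd d < snd c"

definition noncrossing :: "(nat \<times> nat) set \<Rightarrow> bool" where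
  "noncrossing T \<longleftrightarrow> (\<forall>c \<in> T. \<forall>d \<in> T. \<not> crossing c d)"

lemma finite_chords [simp]: "finite (chords n)"
  by (rule finite_subset[of _ "{..n + 2} \<times> {..n + 2}"]) (auto simp: chords_def)

lemma diagonals_eq: "diagonals n p = chord_segment p ` chords n"
  unfolding diagonals_def chords_def chord_segment_def by (force simp: image_def)

lemma inj_on_chord_segment:
  assumes "convex_gon n p"
  shows "inj_on (chord_segment p) (chords n)"
proof (rule inj_onI, clarify)
  fix i j k l
  assume c: "(i, j) \<in> chords n" "(k, l) \<in> chords n"
    and eq: "chord_segment p (i, j) = chord_segment p (k, l)"
  have "{p i, p j} = {p k, p l}"
    using eq by (simp add: chord_segment_def)
  then have "p ` {i, j} = p ` {k, l}" by simp
  then have "{i, j} = {k, l}"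
    by (rule inj_on_image_eq_iff[THEN iffD1, OF convex_gon_inj[OF assms], rotated 2])
       (use c in \<open>auto simp: chords_def\<close>)
  then show "i = k \<and> j = l"
    using c by (auto simp: chords_def doubleton_eq_iff)
qed

text \<open>
  The vertices of a quadrilateral satisfy a linear relation whose coefficients are the signed areas
  of its four triangles (\<open>rel\<close> below); here they are positive. After division by the area of the
  quadrilateral, the two sides of the relation are convex combinations on the two diagonals, so they
  are a common point.
\<close>

lemma crossing_segments_meet:
  assumes gon: "convex_gon n p" and "i < k" "k < j" "j < l" "l \<le> n + 2"
  shows "open_segment (p i) (p j) \<inter> open_segment (p k) (p l) \<noteq> {}"
proof -
  let ?A = "orient (p i) (p j) (p l)" and ?B = "orient (p i) (p k) (p j)"
  let ?C = "orient (p i) (p k) (p l)" and ?D = "orient (p k) (p j) (p l)"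
  have pos: "?A > 0" "?B > 0" "?C > 0" "?D > 0"
    using assms by (auto intro!: convex_gon_orient[OF gon])
  have sum: "?A + ?B = ?C + ?D"
    by (simp add: orient_def algebra_simps)
  have rel: "?A *\<^sub>R p k + ?B *\<^sub>R p l = ?D *\<^sub>R p i + ?C *\<^sub>R p j"
    unfolding vec_eq_iff forall_2 orient_def by (simp add: algebra_simps)
  let ?s = "?A + ?B"
  have s: "?s > 0" using pos by simp
  define x where "x = (1 / ?s) *\<^sub>R (?A *\<^sub>R p k + ?B *\<^sub>R p l)"
  have inj: "p i \<noteq> p j" "p k \<noteq> p l"
    using convex_gon_inj[OF gon] assms by (auto dest: inj_onD)
  have "x = (1 - ?B / ?s) *\<^sub>R p k + (?B / ?s) *\<^sub>R p l"
  proof -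
    have "1 - ?B / ?s = ?A / ?s" using s by (simp add: field_simps)
    then show ?thesis by (simp add: x_def scaleR_add_right)
  qed
  moreover have "0 < ?B / ?s" "?B / ?s < 1" using pos s by (auto simp: field_simps)
  ultimately have 1: "x \<in> open_segment (p k) (p l)"
    using inj by (auto simp: in_segment)
  have "x = (1 - ?C / ?s) *\<^sub>R p i + (?C / ?s) *\<^sub>R p j"
  proof -
    have "1 - ?C / ?s = ?D / ?s" using s sum by (simp add: field_simps)
    then show ?thesis by (simp add: x_def rel scaleR_add_right)
  qed
  moreover have "0 < ?C / ?s" "?C / ?s < 1" using pos s sum by (auto simp: field_simps)
  ultimately have 2: "x \<in> open_segment (p i) (p j)"
    using inj by (auto simp: in_segment)
  from 1 2 show ?thesis by blast
qed

lemma convex_combination_pos: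
  fixes a b u :: real
  assumes "0 < u" "u < 1" "0 \<le> a" "0 \<le> b" "a \<noteq> 0 \<or> b \<noteq> 0"
  shows "0 < (1 - u) * a + u * b"
proof -
  have "0 \<le> (1 - u) * a" "0 \<le> u * b" using assms by simp_all
  moreover have "(1 - u) * a \<noteq> 0 \<or> u * b \<noteq> 0" using assms by simp
  ultimately show ?thesis by linarith
qed

text \<open>
  If two distinct chords do not cross, both ends of the second lie weakly on one side of the first,
  and not both of them on its line. So the signed area is nonzero in the interior of the second
  chord and zero on the first.
\<close>

lemma noncrossing_segments_disjoint:
  assumes gon: "convex_gon n p" and c: "(i, j) \<in> chords n" "(k, l) \<in> chords n"
    and "(i, j) \<noteq> (k, l)" "\<not> crossing (i, j) (k, l)"
  shows "open_segment (p i) (p j) \<inter> open_segment (p k) (p l) = {}"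
proof (rule ccontr)
  let ?o = "orient (p i) (p j)"
  assume "\<not> ?thesis"
  then obtain x where x: "x \<in> open_segment (p i) (p j)" "x \<in> open_segment (p k) (p l)" by blast
  obtain u where u: "0 < u" "u < 1" "x = (1 - u) *\<^sub>R p k + u *\<^sub>R p l"
    using x(2) by (auto simp: in_segment)
  have zero: "?o x = 0"
    using x(1) by (auto simp: in_segment orient_affine)
  have ox: "?o x = (1 - u) * ?o (p k) + u * ?o (p l)"
    using u by (simp add: orient_affine)
  have ord: "i < j" "j \<le> n + 2" "k < l" "l \<le> n + 2" using c by (auto simp: chords_def)
  have neg: "?o (p m) < 0" if "i < m" "m < j" for m
    using orient_neg_inside[OF gon that ord(2)] .
  have pos: "?o (p m) > 0" if "m < i \<or> j < m" "m \<le> n + 2" for m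
    using orient_pos_outside[OF gon ord(1,2)] that by blast
  have end0: "?o (p m) = 0" if "m = i \<or> m = j" for m using that by auto
  have "i \<le> k \<and> l \<le> j \<or> (k \<le> i \<or> j \<le> k) \<and> (l \<le> i \<or> j \<le> l)"
    using assms(5) ord unfolding crossing_def fst_conv snd_conv by linarith
  then consider "i \<le> k" "l \<le> j" | "k \<le> i \<or> j \<le> k" "l \<le> i \<or> j \<le> l"
    by blast
  then show False
  proof cases
    case 1
    have le: "?o (p m) \<le> 0" if "i \<le> m" "m \<le> j" for m
    proof (cases "m = i \<or> m = j")
      case False
      then show ?thesis using that by (intro less_imp_le neg) auto
    qed auto
    have "i < k \<and> k < j \<or> i < l \<and> l < j"
      using 1 ord assms(4) by auto
    then have "?o (p k) \<noteq> 0 \<or> ?o (p l) \<noteq> 0"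
      using neg by (metis less_irrefl)
    then have "0 < (1 - u) * (- ?o (p k)) + u * (- ?o (p l))"
      using le[of k] le[of l] 1 ord u by (intro convex_combination_pos) auto
    then show False using zero ox by (simp add: algebra_simps)
  next
    case 2
    have ge: "?o (p m) \<ge> 0" if "m \<le> i \<or> j \<le> m" "m \<le> n + 2" for m
    proof (cases "m = i \<or> m = j")
      case False
      then show ?thesis using that by (intro less_imp_le, intro pos) auto
    qed auto
    have "(k < i \<or> j < k) \<or> (l < i \<or> j < l)"
      using 2 ord assms(4) by auto
    then have "?o (p k) \<noteq> 0 \<or> ?o (p l) \<noteq> 0"
      using pos[of k] pos[of l] ord by (metis less_irrefl order_trans less_imp_le)
    then have "0 < (1 - u) * ?o (p k) + u * ?o (p l)"
      using ge[of k] ge[of l] 2 ord u by (intro convex_combination_pos) auto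
    then show False using zero ox by simp
  qed
qed

lemma disjnt_chords_iff:
  assumes gon: "convex_gon n p" and c: "c \<in> chords n" "d \<in> chords n" and "c \<noteq> d"
  shows "disjnt (rel_interior (chord_segment p c)) (rel_interior (chord_segment p d))
           \<longleftrightarrow> \<not> crossing c d"
proof -
  obtain i j k l where ij: "c = (i, j)" "d = (k, l)" by fastforce
  have ord: "i < j" "j \<le> n + 2" "k < l" "l \<le> n + 2" using c by (auto simp: chords_def ij)
  have "p i \<noteq> p j" "p k \<noteq> p l"
    using convex_gon_inj[OF gon] ord by (auto dest: inj_onD)
  then have ri: "rel_interior (chord_segment p c) = open_segment (p i) (p j)"
      "rel_interior (chord_segment p d) = open_segment (p k) (p l)"
    by (simp_all add: chord_segment_def ij rel_interior_closed_segment)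
  show ?thesis
  proof (cases "crossing c d")
    case False
    then show ?thesis
      using noncrossing_segments_disjoint[OF gon, of i j k l] c assms(4)
      unfolding disjnt_def ri by (simp add: ij)
  next
    case True
    then have "open_segment (p i) (p j) \<inter> open_segment (p k) (p l) \<noteq> {}"
      using crossing_segments_meet[OF gon, of i k j l] crossing_segments_meet[OF gon, of k i l j] ord
      unfolding crossing_def ij by (auto simp: Int_commute)
    then show ?thesis using True by (simp add: disjnt_def ri)
  qed
qed

lemma subdivisions_eq:
  assumes gon: "convex_gon n p"
  shows "subdivisions n p = image (chord_segment p) ` {T. T \<subseteq> chords n \<and> noncrossing T}"
proof -
  have "pairwise (\<lambda>D E. disjnt (rel_interior D) (rel_interior E)) (chord_segment p ` T)
          \<longleftrightarrow> noncrossing T" if T: "T \<subseteq> chords n" for T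
  proof -
    have inj: "inj_on (chord_segment p) T"
      using inj_on_chord_segment[OF gon] T by (rule inj_on_subset)
    have "pairwise (\<lambda>D E. disjnt (rel_interior D) (rel_interior E)) (chord_segment p ` T)
        \<longleftrightarrow> (\<forall>c\<in>T. \<forall>d\<in>T. c \<noteq> d \<longrightarrow>
             disjnt (rel_interior (chord_segment p c)) (rel_interior (chord_segment p d)))"
      using inj by (auto simp: pairwise_def inj_on_eq_iff)
    also have "\<dots> \<longleftrightarrow> (\<forall>c\<in>T. \<forall>d\<in>T. c \<noteq> d \<longrightarrow> \<not> crossing c d)"
      using disjnt_chords_iff[OF gon] T by (meson subsetD)
    also have "\<dots> \<longleftrightarrow> noncrossing T"
      by (auto simp: noncrossing_def crossing_def)
    finally show ?thesis .
  qed
  then show ?thesis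
    unfolding subdivisions_def diagonals_eq by (auto simp: subset_image_iff)
qed

text \<open>
  If no selected vertex is cut off by the chord, all other selected vertices are strictly on the
  same side of it, which makes the chord an edge. If a selected vertex \<open>l\<close> is cut off, one of
  the vertices \<open>0\<close> and \<open>n + 2\<close> is on the other side, and the segment joining it to \<open>l\<close> runs
  through the interior of the chord, which a face does not allow.
\<close>

lemma edge_of_hull_iff:
  assumes gon: "convex_gon n p" and I: "I \<subseteq> {..n + 2}" "0 \<in> I" "n + 2 \<in> I"
    and ij: "(i, j) \<in> chords n"
  shows "chord_segment p (i, j) edge_of convex hull (p ` I)
           \<longleftrightarrow> i \<in> I \<and> j \<in> I \<and> (\<forall>l \<in> I. \<not> (i < l \<and> l < j))"
proof
  have ord: "i + 1 < j" "j \<le> n + 2" "(i, j) \<noteq> (0, n + 2)" using ij by (auto simp: chords_def)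
  note inj = convex_gon_inj[OF gon]
  have neq: "p i \<noteq> p j" using inj ord by (auto dest: inj_onD)
  {
    assume "chord_segment p (i, j) edge_of convex hull (p ` I)"
    then have face: "closed_segment (p i) (p j) face_of convex hull (p ` I)"
      by (simp add: edge_of_def chord_segment_def)
    have mem: "m \<in> I" if "m = i \<or> m = j" for m
    proof -
      have "p m extreme_point_of closed_segment (p i) (p j)"
        using that by (auto simp: extreme_point_of_segment)
      then have "p m extreme_point_of convex hull (p ` I)"
        using extreme_point_of_face[OF face] by blast
      then have "p m \<in> p ` I" by (rule extreme_point_of_convex_hull)
      moreover have "m \<in> {..n + 2}" using that ord by auto
      ultimately show ?thesis by (simp add: inj_on_image_mem_iff[OF inj _ I(1)])
    qed
    have "\<not> (i < l \<and> l < j)" if l: "l \<in> I" for l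
    proof
      assume between: "i < l \<and> l < j"
      \<comment> \<open>One of the two outermost vertices lies on the other side of the chord.\<close>
      obtain m where m: "m \<in> I" "m < i \<or> j < m" "m \<le> n + 2"
        using ord I by (metis le_neq_implies_less neq0_conv order_refl zero_le)
      have "open_segment (p i) (p j) \<inter> open_segment (p l) (p m) \<noteq> {}"
        using m(2)
      proof
        assume "m < i"
        then show ?thesis
          using crossing_segments_meet[OF gon, of m i l j] between ord
          by (auto simp: Int_commute open_segment_commute)
      next
        assume "j < m"
        then show ?thesis
          using crossing_segments_meet[OF gon, of i l j m] between m by auto
      qed
      then obtain x where x: "x \<in> closed_segment (p i) (p j)" "x \<in> open_segment (p l) (p m)"
        by (auto simp: open_segment_def)
      have "p l \<in> convex hull (p ` I)" "p m \<in> convex hull (p ` I)"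
        using l m by (auto intro: hull_inc)
      then have "p l \<in> closed_segment (p i) (p j)"
        using face x unfolding face_of_def by blast
      then have "orient (p i) (p j) (p l) = 0"
        by (auto simp: in_segment orient_affine)
      then show False
        using orient_neg_inside[OF gon, of i l j] between ord by simp
    qed
    with mem show "i \<in> I \<and> j \<in> I \<and> (\<forall>l \<in> I. \<not> (i < l \<and> l < j))" by blast
  }
  {
    assume R: "i \<in> I \<and> j \<in> I \<and> (\<forall>l \<in> I. \<not> (i < l \<and> l < j))"
    have aff: "affine hull {p i, p j} \<subseteq> {x. orient (p i) (p j) x = 0}"
      by (auto simp: affine_hull_2 orient_affine)
    have conv: "convex {x. orient (p i) (p j) x > 0}"
      unfolding convex_alt
    proof clarsimp
      fix x y and u :: real
      assume a: "0 < orient (p i) (p j) x" "0 < orient (p i) (p j) y" "0 \<le> u" "u \<le> 1"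
      then show "0 < orient (p i) (p j) ((1 - u) *\<^sub>R x + u *\<^sub>R y)"
        by (cases "u = 0") (auto simp: orient_affine intro!: add_nonneg_pos)
    qed
    have "p ` I - {p i, p j} \<subseteq> {x. orient (p i) (p j) x > 0}"
    proof clarsimp
      fix l assume l: "l \<in> I" "p l \<noteq> p i" "p l \<noteq> p j"
      then have "l < i \<or> j < l" using R by (metis linorder_neqE_nat)
      then show "orient (p i) (p j) (p l) > 0"
        using orient_pos_outside[OF gon, of i j l] ord l I by auto
    qed
    then have "convex hull (p ` I - {p i, p j}) \<subseteq> {x. orient (p i) (p j) x > 0}"
      using conv by (rule hull_minimal)
    then have disj: "affine hull {p i, p j} \<inter> convex hull (p ` I - {p i, p j}) = {}"
      using aff by fastforce
    have "convex hull {p i, p j} face_of convex hull (p ` I)"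
      by (rule face_of_convex_hulls[OF _ _ disj]) (use R I in \<open>auto intro: finite_subset\<close>)
    then show "chord_segment p (i, j) edge_of convex hull (p ` I)"
      using neq
      by (simp add: edge_of_def chord_segment_def segment_convex_hull aff_dim_convex_hull aff_dim_2)
  }
qed

section \<open>Sight lines of a height function\<close>

definition visible :: "(nat \<Rightarrow> 'b::linorder) \<Rightarrow> nat \<Rightarrow> nat \<Rightarrow> bool" where
  "visible W i j \<longleftrightarrow> (\<forall>l. i < l \<and> l < j \<longrightarrow> W l < W i \<and> W l < W j)"

definition sightlines :: "nat \<Rightarrow> (nat \<Rightarrow> 'b::linorder) \<Rightarrow> (nat \<times> nat) set" where
  "sightlines n W = {(i, j) \<in> chords n. visible W i j}"

text \<open>
  Abstracts the infinite weights at \<open>0\<close> and \<open>n + 2\<close> to two positions higher than all those in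
  between, so that heights may lie in any linear order.
\<close>

definition walled :: "nat \<Rightarrow> (nat \<Rightarrow> 'b::linorder) \<Rightarrow> bool" where
  "walled n W \<longleftrightarrow> (\<forall>k. 1 \<le> k \<and> k \<le> n + 1 \<longrightarrow> W k < W 0 \<and> W k < W (n + 2))"

definition argmax :: "(nat \<Rightarrow> 'b::linorder) \<Rightarrow> nat \<Rightarrow> nat \<Rightarrow> nat set" where
  "argmax W i j = {k \<in> {i..j}. \<forall>l \<in> {i..j}. W l \<le> W k}"

lemma argmax_nonempty: "i \<le> j \<Longrightarrow> argmax W i j \<noteq> {}"
proof -
  assume "i \<le> j"
  then have "finite (W ` {i..j})" "W ` {i..j} \<noteq> {}" by auto
  then have "Max (W ` {i..j}) \<in> W ` {i..j}" by (rule Max_in)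
  then obtain k where "k \<in> {i..j}" "Max (W ` {i..j}) = W k" by auto
  then have "k \<in> argmax W i j"
    by (auto simp: argmax_def intro: Max_ge[of "W ` {i..j}", THEN order_trans])
  then show ?thesis by blast
qed

lemma finite_sightlines [simp]: "finite (sightlines n W)"
  by (rule finite_subset[of _ "chords n"]) (auto simp: sightlines_def)

text \<open>
  If \<open>(i, j)\<close> and \<open>(k, l)\<close> cross, then \<open>k\<close> is below the first line and hence lower than \<open>j\<close>, while \<open>j\<close> is
  below the second and hence lower than \<open>k\<close>.
\<close>

lemma noncrossing_sightlines: "noncrossing (sightlines n W)"
proof -
  have False if "visible W i j" "visible W k l" "i < k" "k < j" "j < l" for i j k l
  proof -
    have "W k < W j" "W j < W k" using that by (auto simp: visible_def)
    then show False by simp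
  qed
  then show ?thesis
    unfolding noncrossing_def crossing_def sightlines_def by fastforce
qed

lemma nearest_larger:
  assumes "walled n W" "1 \<le> k" "k \<le> n + 1"
  obtains l r where "l < k" "k < r" "r \<le> n + 2" "W k < W l" "W k < W r"
    "\<And>m. l < m \<Longrightarrow> m < r \<Longrightarrow> W m \<le> W k"
proof -
  let ?L = "{m. m < k \<and> W k < W m}"
  let ?R = "\<lambda>m. k < m \<and> W k < W m"
  have "0 \<in> ?L" using assms by (auto simp: walled_def)
  then have L: "finite ?L" "?L \<noteq> {}" by auto
  have R: "?R (n + 2)" using assms by (auto simp: walled_def)
  have l: "Max ?L \<in> ?L" using L by (rule Max_in)
  have r: "?R (LEAST m. ?R m)" "(LEAST m. ?R m) \<le> n + 2"
    using R by (rule LeastI, rule Least_le)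
  show ?thesis
  proof (rule that[of "Max ?L" "LEAST m. ?R m"])
    fix m assume m: "Max ?L < m" "m < (LEAST m. ?R m)"
    have "m \<notin> ?L" using m(1) Max_ge[OF L(1), of m] by fastforce
    moreover have "\<not> ?R m" using not_less_Least[OF m(2)] .
    ultimately show "W m \<le> W k"
      by (cases m k rule: linorder_cases) auto
  qed (use l r in auto)
qed

text \<open>
  From right to left: \<open>i\<close> sees \<open>j\<close> exactly if \<open>i\<close> is the only highest position in \<open>{i..j - 1}\<close> and
  \<open>j\<close> the only one in \<open>{i + 1..j}\<close>, with the conditions at the walls being void.
  From left to right: suppose that \<open>k\<close> is highest for \<open>W\<close> on an interval but not for \<open>V\<close>. The
  nearest positions to its left and right that are higher for \<open>V\<close> see each other under \<open>V\<close>, hence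
  under \<open>W\<close>, and are both higher than \<open>k\<close> for \<open>W\<close>; but one of them lies in the interval.
\<close>

lemma sightlines_subset_iff:
  assumes W: "walled n W" and V: "walled n V"
  shows "sightlines n V \<subseteq> sightlines n W
    \<longleftrightarrow> (\<forall>i j. 1 \<le> i \<and> i \<le> j \<and> j \<le> n + 1 \<longrightarrow> argmax W i j \<subseteq> argmax V i j)"
    (is "?L \<longleftrightarrow> ?R")
proof
  assume R: ?R
  show ?L
  proof (clarsimp simp: sightlines_def)
    fix i j assume ij: "(i, j) \<in> chords n" and vis: "visible V i j"
    have ord: "i + 1 < j" "j \<le> n + 2" using ij by (auto simp: chords_def)
    have "W l < W i \<and> W l < W j" if l: "i < l" "l < j" for l
    proof
      show "W l < W i"
      proof (cases "i = 0")
        case True then show ?thesis using W l ord by (auto simp: walled_def)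
      next
        case False
        then have "1 \<le> i \<and> i \<le> j - 1 \<and> j - 1 \<le> n + 1" using ord by linarith
        then have sub: "argmax W i (j - 1) \<subseteq> argmax V i (j - 1)" using R by blast
        have "m = i" if "m \<in> argmax V i (j - 1)" for m
        proof (rule ccontr)
          assume "m \<noteq> i"
          then have "V m < V i" using vis that by (auto simp: argmax_def visible_def)
          moreover have "V i \<le> V m" using that by (auto simp: argmax_def)
          ultimately show False by simp
        qed
        then have one: "m = i" if "m \<in> argmax W i (j - 1)" for m using sub that by blast
        moreover have "argmax W i (j - 1) \<noteq> {}" using ord by (intro argmax_nonempty) auto
        ultimately have i: "i \<in> argmax W i (j - 1)" by blast
        have "l \<notin> argmax W i (j - 1)" using one l by blast
        then obtain m where m: "m \<in> {i..j - 1}" "W l < W m"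
          using l by (auto simp: argmax_def not_le)
        have "W m \<le> W i" using i m(1) by (simp add: argmax_def)
        then show ?thesis using m(2) by simp
      qed
      show "W l < W j"
      proof (cases "j = n + 2")
        case True then show ?thesis using W l ord by (auto simp: walled_def)
      next
        case False
        then have "1 \<le> i + 1 \<and> i + 1 \<le> j \<and> j \<le> n + 1" using ord by linarith
        then have sub: "argmax W (i + 1) j \<subseteq> argmax V (i + 1) j" using R by blast
        have "m = j" if "m \<in> argmax V (i + 1) j" for m
        proof (rule ccontr)
          assume "m \<noteq> j"
          then have "V m < V j" using vis that by (auto simp: argmax_def visible_def)
          moreover have "V j \<le> V m" using that by (auto simp: argmax_def)
          ultimately show False by simp
        qed
        then have one: "m = j" if "m \<in> argmax W (i + 1) j" for m using sub that by blast
        moreover have "argmax W (i + 1) j \<noteq> {}" using ord by (intro argmax_nonempty) auto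
        ultimately have j: "j \<in> argmax W (i + 1) j" by blast
        have "l \<notin> argmax W (i + 1) j" using one l by blast
        then obtain m where m: "m \<in> {i + 1..j}" "W l < W m"
          using l by (auto simp: argmax_def not_le)
        have "W m \<le> W j" using j m(1) by (simp add: argmax_def)
        then show ?thesis using m(2) by simp
      qed
    qed
    then show "visible W i j" by (simp add: visible_def)
  qed
next
  assume L: ?L
  show ?R
  proof (intro allI impI subsetI, elim conjE, rule ccontr)
    fix i j k
    assume ij: "1 \<le> i" "i \<le> j" "j \<le> n + 1" and k: "k \<in> argmax W i j" and nk: "k \<notin> argmax V i j"
    have kij: "i \<le> k" "k \<le> j" using k by (auto simp: argmax_def)
    then have "1 \<le> k" "k \<le> n + 1" using ij by auto
    then obtain l r where lr: "l < k" "k < r" "r \<le> n + 2" "V k < V l" "V k < V r"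
        and btw: "\<And>m. l < m \<Longrightarrow> m < r \<Longrightarrow> V m \<le> V k"
      using nearest_larger[OF V] by metis
    obtain m where m: "m \<in> {i..j}" "V k < V m"
      using nk kij by (auto simp: argmax_def not_le)
    have inside: "i \<le> l \<or> r \<le> j"
      using btw[of m] m by fastforce
    have "visible V l r" using btw lr by (meson le_less_trans visible_def)
    moreover have "(l, r) \<in> chords n" using lr inside ij by (auto simp: chords_def)
    ultimately have "visible W l r" using L by (auto simp: sightlines_def)
    then have "W k < W l" "W k < W r" using lr by (auto simp: visible_def)
    moreover have "l \<in> {i..j} \<or> r \<in> {i..j}" using inside lr kij by auto
    ultimately show False using k by (force simp: argmax_def)
  qed
qed

text \<open>
  The number of diagonals in \<open>T\<close> that separate the vertex \<open>k\<close> from the side joining the first and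
  the last vertex.
\<close>

definition depth :: "(nat \<times> nat) set \<Rightarrow> nat \<Rightarrow> nat" where
  "depth T k = card {c \<in> T. fst c < k \<and> k < snd c}"

lemma depth_lessE:
  assumes "finite T" "depth T k < depth T l"
  obtains x y where "(x, y) \<in> T" "x < l" "l < y" "\<not> (x < k \<and> k < y)"
proof -
  let ?S = "\<lambda>k. {c \<in> T. fst c < k \<and> k < snd c}"
  have "card (?S l) \<le> card (?S k)" if "?S l \<subseteq> ?S k"
    using assms(1) that by (intro card_mono) auto
  then have "\<not> ?S l \<subseteq> ?S k" using assms(2) unfolding depth_def by linarith
  then show thesis using that by force
qed

text \<open>
  A diagonal in \<open>T\<close> is a sight line, because whatever diagonal lies above one of its ends lies, by
  non-crossing, above everything below the diagonal, which is in addition below the diagonal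
  itself.

  Conversely, let \<open>i\<close> see \<open>j\<close>. If \<open>j\<close> is not a wall: as \<open>j - 1\<close> is deeper than \<open>j\<close>, some diagonal
  in \<open>T\<close> ends in \<open>j\<close> from the left. The widest of these starts at some \<open>c \<le> i\<close>: otherwise \<open>c\<close> would
  lie below the sight line and so be deeper than \<open>j\<close>, but a diagonal witnessing this would either
  cross \<open>(c, j)\<close> or be wider. Symmetrically, if \<open>i\<close> is not a wall, the widest diagonal starting in
  \<open>i\<close> ends at some \<open>b \<ge> j\<close>. If neither of the two is \<open>(i, j)\<close>, they cross. If one end is a wall,
  the diagonal found at the other end cannot reach beyond it and is \<open>(i, j)\<close>.
\<close>

lemma sightlines_depth:
  assumes T: "T \<subseteq> chords n" "noncrossing T" and W: "walled n W"
    and depth: "\<And>k l. \<lbrakk>1 \<le> k; k \<le> n + 1; 1 \<le> l; l \<le> n + 1\<rbrakk> \<Longrightarrow>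
                  W k < W l \<longleftrightarrow> depth T l < depth T k"
  shows "sightlines n W = T"
proof
  have fin: "finite T" using T(1) finite_chords by (rule finite_subset)
  have nc: False if "(x, y) \<in> T" "(z, t) \<in> T" "x < z" "z < y" "y < t" for x y z t
    using T(2) that by (force simp: noncrossing_def crossing_def)
  show "T \<subseteq> sightlines n W"
  proof clarify
    fix i j assume ij: "(i, j) \<in> T"
    then have ord: "i + 1 < j" "j \<le> n + 2" "(i, j) \<in> chords n" using T by (auto simp: chords_def)
    let ?S = "\<lambda>k. {c \<in> T. fst c < k \<and> k < snd c}"
    have deeper: "depth T m < depth T l" if "i < l" "l < j" "m = i \<or> m = j" for l m
    proof -
      have "x < l \<and> l < y" if xy: "(x, y) \<in> T" "x < m" "m < y" for x y
      proof -
        have "x < i \<Longrightarrow> i < y \<Longrightarrow> \<not> y < j" using nc[OF xy(1) ij] by blast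
        moreover have "i < x \<Longrightarrow> x < j \<Longrightarrow> \<not> j < y" using nc[OF ij xy(1)] by blast
        ultimately show ?thesis
          using xy(2,3) \<open>i < l\<close> \<open>l < j\<close> \<open>m = i \<or> m = j\<close> by linarith
      qed
      then have "?S m \<subseteq> ?S l" by auto
      moreover have "(i, j) \<in> ?S l" "(i, j) \<notin> ?S m" using ij that by auto
      ultimately have "?S m \<subset> ?S l" by blast
      then show ?thesis
        unfolding depth_def using fin by (intro psubset_card_mono) auto
    qed
    have "W l < W i \<and> W l < W j" if "i < l" "l < j" for l
    proof
      show "W l < W i"
        using W depth[of l i] deeper[of l i] that ord by (cases "i = 0") (auto simp: walled_def)
      show "W l < W j"
        using W depth[of l j] deeper[of l j] that ord by (cases "j = n + 2") (auto simp: walled_def)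
    qed
    then show "(i, j) \<in> sightlines n W" using ord by (auto simp: sightlines_def visible_def)
  qed
  show "sightlines n W \<subseteq> T"
  proof clarify
    fix i j assume "(i, j) \<in> sightlines n W"
    then have ord: "i + 1 < j" "j \<le> n + 2" "(i, j) \<noteq> (0, n + 2)" and vis: "visible W i j"
      by (auto simp: sightlines_def chords_def)
    have right: "\<exists>c \<le> i. (c, j) \<in> T" if j: "j \<le> n + 1"
    proof -
      have "depth T j < depth T (j - 1)"
        using depth[of "j - 1" j] vis ord j by (auto simp: visible_def)
      then obtain x y where xy: "(x, y) \<in> T" "x < j - 1" "j - 1 < y" "\<not> (x < j \<and> j < y)"
        using fin by (elim depth_lessE)
      then have "(x, j) \<in> T" using ord by (cases "y = j") auto
      define c where "c = (LEAST c. (c, j) \<in> T)"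
      have c: "(c, j) \<in> T" unfolding c_def using \<open>(x, j) \<in> T\<close> by (rule LeastI)
      have "c \<le> i"
      proof (rule ccontr)
        assume "\<not> c \<le> i"
        moreover have "c + 1 < j" using c T by (auto simp: chords_def)
        ultimately have "depth T j < depth T c"
          using depth[of c j] vis ord j by (auto simp: visible_def)
        then obtain x y where xy: "(x, y) \<in> T" "x < c" "c < y" "\<not> (x < j \<and> j < y)"
          using fin by (elim depth_lessE)
        have "y \<le> j" using xy \<open>c + 1 < j\<close> by auto
        moreover have "y \<noteq> j" using xy not_less_Least[of x "\<lambda>c. (c, j) \<in> T"] by (auto simp: c_def)
        ultimately show False using nc[OF xy(1) c] xy by auto
      qed
      with c show ?thesis by blast
    qed
    have left: "\<exists>b \<ge> j. (i, b) \<in> T" if i: "1 \<le> i"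
    proof -
      let ?B = "{b. (i, b) \<in> T}"
      have "depth T i < depth T (i + 1)"
        using depth[of "i + 1" i] vis ord i by (auto simp: visible_def)
      then obtain x y where xy: "(x, y) \<in> T" "x < i + 1" "i + 1 < y" "\<not> (x < i \<and> i < y)"
        using fin by (elim depth_lessE)
      then have iy: "(i, y) \<in> T" by (cases "x = i") auto
      have finB: "finite ?B"
        by (rule finite_subset[of _ "{..n + 2}"]) (use T in \<open>auto simp: chords_def\<close>)
      define b where "b = Max ?B"
      have b: "(i, b) \<in> T" using Max_in[OF finB] iy by (auto simp: b_def)
      have "j \<le> b"
      proof (rule ccontr)
        assume "\<not> j \<le> b"
        moreover have "i + 1 < b" using b T by (auto simp: chords_def)
        ultimately have "depth T i < depth T b"
          using depth[of b i] vis ord i by (auto simp: visible_def)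
        then obtain x y where xy: "(x, y) \<in> T" "x < b" "b < y" "\<not> (x < i \<and> i < y)"
          using fin by (elim depth_lessE)
        have "i \<le> x" using xy \<open>i + 1 < b\<close> by auto
        moreover have "x \<noteq> i" using xy Max_ge[OF finB, of y] by (auto simp: b_def)
        ultimately show False using nc[OF b xy(1)] xy by auto
      qed
      with b show ?thesis by blast
    qed
    consider "i = 0" | "1 \<le> i" "j = n + 2" | "1 \<le> i" "j \<le> n + 1"
      using ord(2) by linarith
    then show "(i, j) \<in> T"
    proof cases
      case 1
      then have "j \<le> n + 1" using ord by auto
      with 1 show ?thesis using right by auto
    next
      case 2
      then obtain b where "j \<le> b" "(i, b) \<in> T" using left by blast
      moreover have "b \<le> n + 2" using calculation T by (auto simp: chords_def)
      ultimately show ?thesis using 2 by auto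
    next
      case 3
      then obtain c b where "c \<le> i" "(c, j) \<in> T" "j \<le> b" "(i, b) \<in> T"
        using left right by blast
      then show ?thesis using nc[of c j i b] ord by (cases "c = i"; cases "b = j") auto
    qed
  qed
qed

text \<open>
  With unique maxima, a sight line or the pair of walls is recovered from the highest
  position strictly between its ends as the pair of nearest higher positions, and every
  position in \<open>{1..n + 1}\<close> arises.
\<close>

lemma card_sightlines:
  assumes W: "walled n W"
    and unique: "\<And>i j k l. \<lbrakk>1 \<le> i; i \<le> j; j \<le> n + 1; k \<in> argmax W i j; l \<in> argmax W i j\<rbrakk> \<Longrightarrow> k = l"
  shows "card (sightlines n W) = n"
proof -
  \<comment> \<open>The walls see each other, but their pair is a side of the polygon and not a chord.\<close>
  let ?R = "insert (0, n + 2) (sightlines n W)"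
  have R: "i + 1 < j \<and> j \<le> n + 2 \<and> visible W i j" if "(i, j) \<in> ?R" for i j
    using that W by (auto simp: sightlines_def chords_def visible_def walled_def)
  define f where "f = (\<lambda>(i, j). SOME k. k \<in> argmax W (i + 1) (j - 1))"
  have f: "f (i, j) \<in> argmax W (i + 1) (j - 1)" if "(i, j) \<in> ?R" for i j
    unfolding f_def using R[OF that] by (auto intro!: some_in_eq[THEN iffD2] argmax_nonempty)
  have peak: "i < f (i, j)" "f (i, j) < j" "W (f (i, j)) < W i" "W (f (i, j)) < W j"
      "\<And>m. i < m \<Longrightarrow> m < j \<Longrightarrow> W m \<le> W (f (i, j))" if "(i, j) \<in> ?R" for i j
  proof -
    show "i < f (i, j)" "f (i, j) < j" "\<And>m. i < m \<Longrightarrow> m < j \<Longrightarrow> W m \<le> W (f (i, j))"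
      using f[OF that] R[OF that] by (auto simp: argmax_def)
    then show "W (f (i, j)) < W i" "W (f (i, j)) < W j"
      using R[OF that] by (auto simp: visible_def)
  qed
  have "bij_betw f ?R {1..n + 1}"
  proof (rule bij_betw_imageI)
    show "inj_on f ?R"
    proof (rule inj_onI)
      fix c d assume c: "c \<in> ?R" and d: "d \<in> ?R" and eq: "f c = f d"
      obtain i j k l where cd: "c = (i, j)" "d = (k, l)" by fastforce
      note p = peak[OF c[unfolded cd(1)]] and q = peak[OF d[unfolded cd(2)]]
      note eq = eq[unfolded cd]
      have "i = k"
        using p(1,2,3) q(1,2,3) p(5)[of k] q(5)[of i] eq by (cases i k rule: linorder_cases) auto
      moreover have "j = l"
        using p(1,2,4) q(1,2,4) p(5)[of l] q(5)[of j] eq by (cases j l rule: linorder_cases) auto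
      ultimately show "c = d" using cd by simp
    qed
    show "f ` ?R = {1..n + 1}"
    proof
      show "f ` ?R \<subseteq> {1..n + 1}"
      proof clarify
        fix i j assume "(i, j) \<in> ?R"
        from peak(1,2)[OF this] R[OF this] show "f (i, j) \<in> {1..n + 1}" by simp
      qed
      show "{1..n + 1} \<subseteq> f ` ?R"
      proof
        fix k assume "k \<in> {1..n + 1}"
        then obtain l r where lr: "l < k" "k < r" "r \<le> n + 2" "W k < W l" "W k < W r"
            and btw: "\<And>m. l < m \<Longrightarrow> m < r \<Longrightarrow> W m \<le> W k"
          using nearest_larger[OF W] by (metis atLeastAtMost_iff)
        have "visible W l r" using btw lr by (meson le_less_trans visible_def)
        then have mem: "(l, r) \<in> ?R" using lr by (auto simp: sightlines_def chords_def)
        have "k \<in> argmax W (l + 1) (r - 1)" using lr btw by (auto simp: argmax_def)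
        then have "f (l, r) = k" using unique[of "l + 1" "r - 1"] f[OF mem] lr by auto
        with mem show "k \<in> f ` ?R" by force
      qed
    qed
  qed
  then have "card ?R = n + 1" by (auto dest: bij_betw_same_card)
  moreover have "(0, n + 2) \<notin> sightlines n W" by (auto simp: sightlines_def chords_def)
  ultimately show ?thesis by simp
qed

section \<open>Maximal faces of Minkowski sums\<close>

lemma max_face_face_of:
  assumes "convex P"
  shows "max_face P w face_of P"
proof (cases "max_face P w = {}")
  case False
  then obtain x where x: "x \<in> P" "\<And>y. y \<in> P \<Longrightarrow> w \<bullet> y \<le> w \<bullet> x"
    by (auto simp: max_face_def)
  then have "max_face P w = P \<inter> {y. w \<bullet> y = w \<bullet> x}"
    by (fastforce simp: max_face_def)
  then show ?thesis
    using face_of_Int_supporting_hyperplane_le[OF assms x(2)] by simp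
qed simp

lemma max_face_nonempty:
  assumes "compact P" "P \<noteq> {}"
  shows "max_face P w \<noteq> {}"
proof -
  have "continuous_on P (\<lambda>x. w \<bullet> x)" by (intro continuous_intros)
  from continuous_attains_sup[OF assms this] show ?thesis by (auto simp: max_face_def)
qed

text \<open>
  Every face of a polytope is exposed, so it is cut out by a supporting hyperplane.
\<close>

lemma nonempty_faces_eq_max_faces:
  assumes "polytope P" "P \<noteq> {}"
  shows "{F \<in> faces P. F \<noteq> {}} = range (max_face P)"
proof (intro equalityI subsetI)
  fix F assume F: "F \<in> {F \<in> faces P. F \<noteq> {}}"
  then have "F exposed_face_of P"
    using assms by (simp add: faces_def exposed_face_of_polyhedron polytope_imp_polyhedron)
  then obtain w b where wb: "P \<subseteq> {x. w \<bullet> x \<le> b}" "F = P \<inter> {x. w \<bullet> x = b}"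
    by (auto simp: exposed_face_of_def)
  obtain z where z: "z \<in> F" using F by auto
  have "F = max_face P w"
  proof (intro equalityI subsetI)
    fix x assume "x \<in> F" then show "x \<in> max_face P w" using wb by (auto simp: max_face_def)
  next
    fix x assume "x \<in> max_face P w"
    then have "x \<in> P" "w \<bullet> z \<le> w \<bullet> x" using z wb by (auto simp: max_face_def)
    then show "x \<in> F" using z wb by (auto intro: antisym)
  qed
  then show "F \<in> range (max_face P)" by blast
next
  fix F assume "F \<in> range (max_face P)"
  then obtain w where w: "F = max_face P w" by blast
  have "F face_of P" unfolding w using assms(1) by (intro max_face_face_of polytope_imp_convex)
  moreover have "F \<noteq> {}"
    unfolding w using assms by (intro max_face_nonempty polytope_imp_compact)
  ultimately show "F \<in> {F \<in> faces P. F \<noteq> {}}" by (simp add: faces_def)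
qed

lemma mem_max_face_hull_iff:
  assumes "x \<in> V"
  shows "x \<in> max_face (convex hull V) w \<longleftrightarrow> (\<forall>u \<in> V. w \<bullet> u \<le> w \<bullet> x)"
proof
  assume "x \<in> max_face (convex hull V) w"
  then show "\<forall>u \<in> V. w \<bullet> u \<le> w \<bullet> x" by (auto simp: max_face_def hull_inc)
next
  assume "\<forall>u \<in> V. w \<bullet> u \<le> w \<bullet> x"
  then have "convex hull V \<subseteq> {u. w \<bullet> u \<le> w \<bullet> x}"
    by (intro hull_minimal) (auto simp: convex_halfspace_le)
  then show "x \<in> max_face (convex hull V) w" using assms by (auto simp: max_face_def hull_inc)
qed

text \<open>
  A face of a polytope is the hull of the vertices it contains, so only vertices need comparing.
\<close>

lemma max_face_hull_subset_iff:
  assumes "finite V"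
  shows "max_face (convex hull V) w \<subseteq> max_face (convex hull V) v
    \<longleftrightarrow> (\<forall>x \<in> V. x \<in> max_face (convex hull V) w \<longrightarrow> x \<in> max_face (convex hull V) v)"
proof
  assume R: "\<forall>x \<in> V. x \<in> max_face (convex hull V) w \<longrightarrow> x \<in> max_face (convex hull V) v"
  have face: "max_face (convex hull V) u face_of convex hull V" for u
    by (simp add: max_face_face_of)
  obtain V' where V': "V' \<subseteq> V" "max_face (convex hull V) w = convex hull V'"
    using face_of_convex_hull_subset[OF finite_imp_compact[OF assms] face] by blast
  have "V' \<subseteq> max_face (convex hull V) v" using R V' by (auto simp: hull_inc)
  then show "max_face (convex hull V) w \<subseteq> max_face (convex hull V) v"
    unfolding V'(2) using face_of_imp_convex[OF face] by (rule hull_minimal)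
qed auto

lemma sum_mem_sum_set:
  assumes "finite A" "\<And>i. i \<in> A \<Longrightarrow> s i \<in> Q i"
  shows "sum s A \<in> sum Q A"
  unfolding set_sum_alt[OF assms(1)] using assms(2) by blast

lemma mem_sum_setE:
  assumes "x \<in> sum Q A" "finite A"
  obtains s where "\<And>i. i \<in> A \<Longrightarrow> s i \<in> Q i" "x = sum s A"
  using assms(1) unfolding set_sum_alt[OF assms(2)] by blast

lemma sum_fun_upd:
  fixes s :: "'i \<Rightarrow> 'a::ab_group_add"
  assumes "finite A" "i \<in> A"
  shows "sum (s(i := y)) A = y + sum s (A - {i})"
proof -
  have "sum (s(i := y)) (A - {i}) = sum s (A - {i})" by (rule sum.cong) auto
  then show ?thesis by (simp add: sum.remove[OF assms])
qed

text \<open>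
  If one summand of a maximal point were not maximal, exchanging it alone would improve the sum.
\<close>

lemma sum_mem_max_face_iff:
  assumes A: "finite A" and s: "\<And>i. i \<in> A \<Longrightarrow> s i \<in> Q i"
  shows "sum s A \<in> max_face (sum Q A) w \<longleftrightarrow> (\<forall>i \<in> A. s i \<in> max_face (Q i) w)"
proof
  assume L: "sum s A \<in> max_face (sum Q A) w"
  show "\<forall>i \<in> A. s i \<in> max_face (Q i) w"
  proof
    fix i assume i: "i \<in> A"
    have "w \<bullet> y \<le> w \<bullet> s i" if y: "y \<in> Q i" for y
    proof -
      have "sum (s(i := y)) A \<in> sum Q A"
        using s y by (intro sum_mem_sum_set[OF A]) auto
      then have "w \<bullet> sum (s(i := y)) A \<le> w \<bullet> sum s A" using L by (simp add: max_face_def)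
      then show ?thesis
        by (simp add: sum_fun_upd[OF A i] sum.remove[OF A i, of s] inner_add_right
            del: fun_upd_apply)
    qed
    then show "s i \<in> max_face (Q i) w" using s[OF i] by (simp add: max_face_def)
  qed
next
  assume R: "\<forall>i \<in> A. s i \<in> max_face (Q i) w"
  have "w \<bullet> y \<le> w \<bullet> sum s A" if y: "y \<in> sum Q A" for y
  proof -
    obtain t where t: "\<And>i. i \<in> A \<Longrightarrow> t i \<in> Q i" "y = sum t A"
      using y A by (rule mem_sum_setE) (rule that)
    have "w \<bullet> t i \<le> w \<bullet> s i" if "i \<in> A" for i
      using R t(1)[OF that] that by (auto simp: max_face_def)
    then show ?thesis by (simp add: t(2) inner_sum_right sum_mono)
  qed
  moreover have "sum s A \<in> sum Q A" using s by (rule sum_mem_sum_set[OF A])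
  ultimately show "sum s A \<in> max_face (sum Q A) w" by (simp add: max_face_def)
qed

lemma max_face_sum_subset_iff:
  assumes A: "finite A" and ne: "\<And>i. i \<in> A \<Longrightarrow> max_face (Q i) w \<noteq> {}"
  shows "max_face (sum Q A) w \<subseteq> max_face (sum Q A) v
    \<longleftrightarrow> (\<forall>i \<in> A. max_face (Q i) w \<subseteq> max_face (Q i) v)"
proof
  assume L: "max_face (sum Q A) w \<subseteq> max_face (sum Q A) v"
  show "\<forall>i \<in> A. max_face (Q i) w \<subseteq> max_face (Q i) v"
  proof (intro ballI subsetI)
    fix i x assume i: "i \<in> A" and x: "x \<in> max_face (Q i) w"
    define s where "s = (\<lambda>i. SOME y. y \<in> max_face (Q i) w)(i := x)"
    have s: "s k \<in> max_face (Q k) w" if "k \<in> A" for k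
      using ne[OF that] x by (auto simp: s_def some_in_eq)
    then have sQ: "s k \<in> Q k" if "k \<in> A" for k using that by (auto simp: max_face_def)
    note iff = sum_mem_max_face_iff[where s = s and Q = Q, OF A sQ]
    have "sum s A \<in> max_face (sum Q A) v" using L s iff[of w] by blast
    then have "s i \<in> max_face (Q i) v" using i iff[of v] by blast
    then show "x \<in> max_face (Q i) v" by (simp add: s_def)
  qed
next
  assume R: "\<forall>i \<in> A. max_face (Q i) w \<subseteq> max_face (Q i) v"
  show "max_face (sum Q A) w \<subseteq> max_face (sum Q A) v"
  proof
    fix x assume x: "x \<in> max_face (sum Q A) w"
    then have "x \<in> sum Q A" by (simp add: max_face_def)
    from this A obtain s where s: "\<And>i. i \<in> A \<Longrightarrow> s i \<in> Q i" "x = sum s A"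
      by (rule mem_sum_setE) (rule that)
    note iff = sum_mem_max_face_iff[where s = s and Q = Q, OF A s(1)]
    show "x \<in> max_face (sum Q A) v"
      using x R iff[of w] iff[of v] unfolding s(2) by blast
  qed
qed

section \<open>The sum of interval simplices and its faces\<close>

definition intervals :: "nat \<Rightarrow> (nat \<times> nat) set" where
  "intervals n = {(i, j). 1 \<le> i \<and> i \<le> j \<and> j \<le> n + 1}"

definition summand ::
    "(nat \<Rightarrow> 'd::finite) \<Rightarrow> (nat \<Rightarrow> nat \<Rightarrow> real) \<Rightarrow> nat \<times> nat \<Rightarrow> (real ^ 'd) set" where
  "summand idx a = (\<lambda>(i, j). (\<lambda>x. a i j *\<^sub>R x) ` interval_simplex idx i j)"

lemma finite_intervals [simp]: "finite (intervals n)"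
  by (rule finite_subset[of _ "{..n + 1} \<times> {..n + 1}"]) (auto simp: intervals_def)

lemma Ass_III_eq: "Ass_III idx n a = sum (summand idx a) (intervals n)"
  by (simp add: Ass_III_def summand_def intervals_def)

lemma summand_eq_hull:
  "summand idx a (i, j) = convex hull ((\<lambda>k. a i j *\<^sub>R axis (idx k) 1) ` {i..j})"
  by (simp add: summand_def interval_simplex_def flip: convex_hull_scaling) (simp add: image_image)

lemma polytope_sum:
  fixes Q :: "'i \<Rightarrow> 'a::euclidean_space set"
  assumes "finite A" "\<And>i. i \<in> A \<Longrightarrow> polytope (Q i)"
  shows "polytope (sum Q A)"
  using assms
proof (induction A rule: finite_induct)
  case empty
  have "polytope (convex hull {0 :: 'a})" by (rule polytope_convex_hull) simp
  then show ?case by (simp add: set_zero)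
next
  case (insert i A)
  obtain S T where ST: "finite S" "Q i = convex hull S" "finite T" "sum Q A = convex hull T"
    using insert unfolding polytope_def by (metis insertCI)
  then have "Q i + sum Q A = convex hull (S + T)" by (simp add: convex_hull_set_plus)
  then show ?case
    using insert.hyps ST by (auto simp: polytope_def intro: finite_set_plus)
qed

lemma polytope_Ass_III: "polytope (Ass_III idx n a)"
  unfolding Ass_III_eq
  by (rule polytope_sum) (auto simp: summand_eq_hull intro!: polytope_convex_hull)

lemma walled_weight: "walled n (weight idx n w)"
  by (simp add: walled_def weight_def)

text \<open>
  The chord \<open>(i, j)\<close> is an edge of the hull at threshold \<open>W k\<close> iff both ends reach the threshold and
  nothing in between does. A suitable threshold exists iff \<open>i\<close> and \<open>j\<close> see each other; the lower of
  the two ends then provides it.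
\<close>

lemma subdiv_of_eq:
  assumes gon: "convex_gon n p"
  shows "subdiv_of idx n p w = chord_segment p ` sightlines n (weight idx n w)"
proof -
  let ?W = "weight idx n w"
  have top: "?W 0 = \<infinity>" "?W (n + 2) = \<infinity>" by (simp_all add: weight_def)
  have "(\<exists>k \<le> n + 2. chord_segment p (i, j) edge_of upper_hull idx n p w k) \<longleftrightarrow> visible ?W i j"
    if ij: "(i, j) \<in> chords n" for i j
  proof -
    have ord: "i + 1 < j" "j \<le> n + 2" using ij by (auto simp: chords_def)
    have "chord_segment p (i, j) edge_of upper_hull idx n p w k \<longleftrightarrow>
        ?W k \<le> ?W i \<and> ?W k \<le> ?W j \<and> (\<forall>l. i < l \<and> l < j \<longrightarrow> ?W l < ?W k)" for k
    proof -
      let ?I = "{l. l \<le> n + 2 \<and> ?W k \<le> ?W l}"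
      have "(\<forall>l \<in> ?I. \<not> (i < l \<and> l < j)) \<longleftrightarrow> (\<forall>l. i < l \<and> l < j \<longrightarrow> \<not> ?W k \<le> ?W l)"
        using less_le_trans[OF _ ord(2)] by (auto intro: less_imp_le)
      moreover have "chord_segment p (i, j) edge_of convex hull (p ` ?I)
          \<longleftrightarrow> i \<in> ?I \<and> j \<in> ?I \<and> (\<forall>l \<in> ?I. \<not> (i < l \<and> l < j))"
        using top by (intro edge_of_hull_iff[OF gon _ _ _ ij]) auto
      ultimately show ?thesis using ord by (simp add: upper_hull_def not_le)
    qed
    then have "(\<exists>k \<le> n + 2. chord_segment p (i, j) edge_of upper_hull idx n p w k) \<longleftrightarrow>
        (\<exists>k \<le> n + 2. ?W k \<le> ?W i \<and> ?W k \<le> ?W j \<and> (\<forall>l. i < l \<and> l < j \<longrightarrow> ?W l < ?W k))"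
      by simp
    also have "\<dots> \<longleftrightarrow> visible ?W i j"
    proof
      assume "\<exists>k \<le> n + 2. ?W k \<le> ?W i \<and> ?W k \<le> ?W j \<and> (\<forall>l. i < l \<and> l < j \<longrightarrow> ?W l < ?W k)"
      then show "visible ?W i j" unfolding visible_def by (meson less_le_trans)
    next
      assume "visible ?W i j"
      then show "\<exists>k \<le> n + 2. ?W k \<le> ?W i \<and> ?W k \<le> ?W j \<and> (\<forall>l. i < l \<and> l < j \<longrightarrow> ?W l < ?W k)"
        using ord by (intro exI[of _ "if ?W i \<le> ?W j then i else j"]) (auto simp: visible_def)
    qed
    finally show ?thesis .
  qed
  then show ?thesis
    unfolding subdiv_of_def diagonals_eq sightlines_def by (auto simp: image_iff)
qed

lemma aff_dim_basis_simplex: "aff_dim (convex hull range (\<lambda>d. axis d 1 :: real ^ 'd)) = int CARD('d) - 1"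
proof -
  have "range (\<lambda>d. axis d 1 :: real ^ 'd) = Basis" by (auto simp: Basis_vec_def)
  moreover have "\<not> affine_dependent (Basis :: (real ^ 'd) set)"
    using independent_Basis affine_dependent_imp_dependent by blast
  ultimately show ?thesis
    using aff_dim_affine_independent[of "Basis :: (real ^ 'd) set"]
    by (simp add: aff_dim_convex_hull)
qed

locale ass_III =
  fixes n :: nat and idx :: "nat \<Rightarrow> 'd::finite" and a :: "nat \<Rightarrow> nat \<Rightarrow> real"
  assumes idx: "bij_betw idx {1..n + 1} UNIV"
    and pos: "\<And>i j. 1 \<le> i \<Longrightarrow> i \<le> j \<Longrightarrow> j \<le> n + 1 \<Longrightarrow> a i j > 0"
begin

abbreviation P :: "(real ^ 'd) set" where "P \<equiv> Ass_III idx n a"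

abbreviation lines :: "real ^ 'd \<Rightarrow> (nat \<times> nat) set" where
  "lines w \<equiv> sightlines n (weight idx n w)"

lemma max_face_summand_nonempty: "c \<in> intervals n \<Longrightarrow> max_face (summand idx a c) w \<noteq> {}"
  by (cases c)
     (simp add: summand_eq_hull intervals_def max_face_nonempty polytope_imp_compact
       polytope_convex_hull)

lemma vertex_mem_max_face_iff:
  assumes "(i, j) \<in> intervals n" "k \<in> {i..j}"
  shows "a i j *\<^sub>R axis (idx k) 1 \<in> max_face (summand idx a (i, j)) w
           \<longleftrightarrow> k \<in> argmax (weight idx n w) i j"
proof -
  have *: "1 \<le> i" "i \<le> j" "j \<le> n + 1" using assms by (auto simp: intervals_def)
  have "a i j *\<^sub>R axis (idx k) 1 \<in> max_face (summand idx a (i, j)) w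
      \<longleftrightarrow> (\<forall>l \<in> {i..j}. a i j * w $ idx l \<le> a i j * w $ idx k)"
    unfolding summand_eq_hull using assms(2)
    by (subst mem_max_face_hull_iff) (auto simp: inner_axis)
  also have "\<dots> \<longleftrightarrow> k \<in> argmax (weight idx n w) i j"
    using pos[OF *] * assms(2) by (auto simp: argmax_def weight_def)
  finally show ?thesis .
qed

text \<open>
  The equivalence on which everything rests: inclusion of faces is compared summand by summand, then
  vertex by vertex within the simplex of an interval, and finally turned into sight lines. The
  positivity of the parameters makes each summand a true copy of its simplex.
\<close>

lemma max_face_subset_iff: "max_face P w \<subseteq> max_face P v \<longleftrightarrow> lines v \<subseteq> lines w"
proof -
  have "max_face (summand idx a (i, j)) w \<subseteq> max_face (summand idx a (i, j)) v
      \<longleftrightarrow> argmax (weight idx n w) i j \<subseteq> argmax (weight idx n v) i j"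
    if ij: "(i, j) \<in> intervals n" for i j
  proof -
    let ?e = "\<lambda>k. a i j *\<^sub>R axis (idx k) (1::real)"
    have "max_face (summand idx a (i, j)) w \<subseteq> max_face (summand idx a (i, j)) v
        \<longleftrightarrow> (\<forall>k \<in> {i..j}. ?e k \<in> max_face (summand idx a (i, j)) w \<longrightarrow>
              ?e k \<in> max_face (summand idx a (i, j)) v)"
      unfolding summand_eq_hull by (subst max_face_hull_subset_iff) auto
    also have "\<dots> \<longleftrightarrow> argmax (weight idx n w) i j \<subseteq> argmax (weight idx n v) i j"
      using vertex_mem_max_face_iff[OF ij] by (auto simp: argmax_def)
    finally show ?thesis .
  qed
  moreover have "max_face P w \<subseteq> max_face P v
      \<longleftrightarrow> (\<forall>c \<in> intervals n. max_face (summand idx a c) w \<subseteq> max_face (summand idx a c) v)"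
    unfolding Ass_III_eq
    by (rule max_face_sum_subset_iff) (simp_all add: max_face_summand_nonempty)
  ultimately have "max_face P w \<subseteq> max_face P v
      \<longleftrightarrow> (\<forall>(i, j) \<in> intervals n. argmax (weight idx n w) i j \<subseteq> argmax (weight idx n v) i j)"
    by (simp add: Ball_def split_paired_all)
  then show ?thesis
    unfolding sightlines_subset_iff[OF walled_weight walled_weight] by (auto simp: intervals_def)
qed

lemma max_face_eq_iff: "max_face P w = max_face P v \<longleftrightarrow> lines w = lines v"
  using max_face_subset_iff[of w v] max_face_subset_iff[of v w] by blast

lemma sightlines_weight_surj:
  assumes "T \<subseteq> chords n" "noncrossing T"
  obtains w where "lines w = T"
proof -
  define w where "w = (\<chi> d. - real (depth T (inv_into {1..n + 1} idx d)))"
  have "weight idx n w k = ereal (- real (depth T k))" if "1 \<le> k" "k \<le> n + 1" for k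
    using that bij_betw_inv_into_left[OF idx, of k] by (simp add: weight_def w_def)
  then have "lines w = T"
    by (intro sightlines_depth[OF assms walled_weight]) simp
  then show thesis by (rule that)
qed

lemma P_nonempty: "P \<noteq> {}"
proof -
  have "\<forall>c \<in> intervals n. \<exists>x. x \<in> summand idx a c"
    using max_face_summand_nonempty[of _ 0] by (fastforce simp: max_face_def)
  then obtain s where "\<forall>c \<in> intervals n. s c \<in> summand idx a c" by metis
  then have "sum s (intervals n) \<in> P"
    unfolding Ass_III_eq by (intro sum_mem_sum_set) auto
  then show ?thesis by blast
qed

lemma max_face_P_nonempty: "max_face P w \<noteq> {}"
  by (intro max_face_nonempty polytope_imp_compact polytope_Ass_III P_nonempty)

lemma nonempty_face_cases:
  assumes "F face_of P" "F \<noteq> {}"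
  obtains w where "F = max_face P w"
proof -
  have "F \<in> range (max_face P)"
    unfolding nonempty_faces_eq_max_faces[OF polytope_Ass_III P_nonempty, symmetric]
    using assms by (simp add: faces_def)
  then show thesis using that by blast
qed

lemma max_face_face: "max_face P w face_of P"
  by (simp add: max_face_face_of polytope_imp_convex polytope_Ass_III)

text \<open>
  The whole polytope is the face of the zero function. At constant height a position between two
  ends is lower than an end only if that end is a wall, and a chord does not join the two walls.
\<close>

lemma max_face_eq_P_iff: "max_face P w = P \<longleftrightarrow> lines w = {}"
proof -
  have "max_face P 0 = P" by (auto simp: max_face_def)
  moreover have "lines 0 = {}"
  proof -
    have False if "(i, j) \<in> chords n" "visible (weight idx n 0) i j" for i j
    proof -
      have "weight idx n 0 (i + 1) < weight idx n 0 i" "weight idx n 0 (i + 1) < weight idx n 0 j"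
        using that by (auto simp: visible_def chords_def)
      then show False using that(1) by (auto simp: weight_def chords_def split: if_splits)
    qed
    then show ?thesis by (auto simp: sightlines_def)
  qed
  ultimately show ?thesis using max_face_eq_iff[of w 0] by simp
qed

text \<open>
  The sum of the coordinates is constant on the polytope, so its dimension is at most \<open>n\<close>. Fixing a
  point in all other summands leaves a translate of the full simplex inside.
\<close>

lemma aff_dim_P: "aff_dim P = int n"
proof (rule antisym)
  have card: "CARD('d) = n + 1" using bij_betw_same_card[OF idx] by simp
  let ?one = "\<Sum>d\<in>UNIV. axis d 1 :: real ^ 'd"
  have one: "?one \<bullet> axis d 1 = 1" for d
    by (simp add: inner_sum_left inner_axis_axis)
  have "?one \<bullet> x = a i j" if "x \<in> summand idx a (i, j)" for x i j
  proof -
    have "summand idx a (i, j) \<subseteq> {x. ?one \<bullet> x = a i j}"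
      unfolding summand_eq_hull by (rule hull_minimal) (auto simp: one convex_hyperplane)
    then show ?thesis using that by blast
  qed
  then have summand: "?one \<bullet> x = (case c of (i, j) \<Rightarrow> a i j)" if "x \<in> summand idx a c" for x c
    using that by (cases c) auto
  have "P \<subseteq> {x. ?one \<bullet> x = (\<Sum>(i, j) \<in> intervals n. a i j)}"
  proof
    fix x assume "x \<in> P"
    then have "x \<in> sum (summand idx a) (intervals n)" by (simp add: Ass_III_eq)
    from this finite_intervals
    obtain s where s: "\<And>c. c \<in> intervals n \<Longrightarrow> s c \<in> summand idx a c" "x = sum s (intervals n)"
      by (rule mem_sum_setE) (rule that)
    have "?one \<bullet> x = (\<Sum>c \<in> intervals n. ?one \<bullet> s c)" unfolding s(2) by (rule inner_sum_right)
    also have "\<dots> = (\<Sum>(i, j) \<in> intervals n. a i j)" using s(1) summand by (intro sum.cong) auto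
    finally show "x \<in> {x. ?one \<bullet> x = (\<Sum>(i, j) \<in> intervals n. a i j)}" by simp
  qed
  then have "aff_dim P \<le> aff_dim {x. ?one \<bullet> x = (\<Sum>(i, j) \<in> intervals n. a i j)}"
    by (rule aff_dim_subset)
  moreover have "?one \<noteq> 0" using one by (metis inner_zero_left zero_neq_one)
  ultimately show "aff_dim P \<le> int n" by (simp add: card)
next
  have card: "CARD('d) = n + 1" using bij_betw_same_card[OF idx] by simp
  let ?I = "intervals n" and ?c = "(1, n + 1)"
  have c: "?c \<in> ?I" by (simp add: intervals_def)
  have "\<forall>c \<in> ?I. \<exists>x. x \<in> summand idx a c"
    using max_face_summand_nonempty[of _ 0] by (fastforce simp: max_face_def)
  then obtain s where s: "\<forall>c \<in> ?I. s c \<in> summand idx a c" by metis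
  have "(+) (sum s (?I - {?c})) ` summand idx a ?c \<subseteq> P"
  proof clarify
    fix x assume x: "x \<in> summand idx a ?c"
    have "sum (s(?c := x)) ?I = sum s (?I - {?c}) + x"
      using sum_fun_upd[OF finite_intervals c] by (simp add: add.commute del: fun_upd_apply)
    moreover have "sum (s(?c := x)) ?I \<in> P"
      unfolding Ass_III_eq using s x by (intro sum_mem_sum_set) auto
    ultimately show "sum s (?I - {?c}) + x \<in> P" by simp
  qed
  then have "aff_dim (summand idx a ?c) \<le> aff_dim P"
    by (metis aff_dim_subset aff_dim_translation_eq)
  moreover have "aff_dim (summand idx a ?c) = int n"
  proof -
    have "(\<lambda>k. axis (idx k) 1 :: real ^ 'd) ` {1..n + 1} = range (\<lambda>d. axis d 1)"
      unfolding bij_betw_imp_surj_on[OF idx, symmetric] by (simp only: image_image)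
    then have dim: "aff_dim (interval_simplex idx 1 (n + 1)) = int n"
      by (simp only: interval_simplex_def aff_dim_basis_simplex card)
    have "a 1 (n + 1) \<noteq> 0" using pos[of 1 "n + 1"] by simp
    then have "inj (\<lambda>x :: real ^ 'd. a 1 (n + 1) *\<^sub>R x)" by (simp add: inj_on_def)
    then have "aff_dim ((\<lambda>x. a 1 (n + 1) *\<^sub>R x) ` interval_simplex idx 1 (n + 1)) = int n"
      using aff_dim_injective_linear_image[OF linear_scale_self] dim by metis
    then show ?thesis by (simp add: summand_def)
  qed
  ultimately show "int n \<le> aff_dim P" by simp
qed

text \<open>
  If an interval had two highest positions, exchanging the corresponding vertices in its summand would
  give two points of the face.
\<close>

lemma card_sightlines_vertex:
  assumes "max_face P w = {v}"
  shows "card (lines w) = n"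
proof (rule card_sightlines[OF walled_weight])
  fix i j k l
  assume ij: "1 \<le> i" "i \<le> j" "j \<le> n + 1"
    and kl: "k \<in> argmax (weight idx n w) i j" "l \<in> argmax (weight idx n w) i j"
  have c: "(i, j) \<in> intervals n" using ij by (simp add: intervals_def)
  have kl': "k \<in> {i..j}" "l \<in> {i..j}" using kl by (auto simp: argmax_def)
  define s where "s = (\<lambda>c. SOME x. x \<in> max_face (summand idx a c) w)"
  have s: "s c \<in> max_face (summand idx a c) w" if "c \<in> intervals n" for c
    unfolding s_def using max_face_summand_nonempty[OF that] by (simp add: some_in_eq)
  have "a i j *\<^sub>R axis (idx m) 1 + sum s (intervals n - {(i, j)}) = v"
    if m: "m \<in> argmax (weight idx n w) i j" "m \<in> {i..j}" for m
  proof -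
    let ?s = "s((i, j) := a i j *\<^sub>R axis (idx m) 1)"
    have t: "?s c \<in> max_face (summand idx a c) w" if "c \<in> intervals n" for c
      using s[OF that] vertex_mem_max_face_iff[OF c m(2)] m(1) by auto
    then have "?s c \<in> summand idx a c" if "c \<in> intervals n" for c
      using that by (auto simp: max_face_def)
    note iff = sum_mem_max_face_iff[where s = ?s and Q = "summand idx a" and w = w,
        OF finite_intervals this]
    have "sum ?s (intervals n) \<in> max_face P w"
      unfolding Ass_III_eq using iff t by blast
    then show ?thesis using assms by (simp add: sum_fun_upd[OF finite_intervals c] del: fun_upd_apply)
  qed
  from this[OF kl(1) kl'(1)] this[OF kl(2) kl'(2)]
  have "a i j *\<^sub>R axis (idx k) (1::real) = a i j *\<^sub>R axis (idx l) 1" by (metis add_right_cancel)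
  then have "idx k = idx l" using pos[OF ij] by (simp add: axis_eq_axis)
  then show "k = l" using bij_betw_imp_inj_on[OF idx] kl' ij by (auto dest: inj_onD)
qed

lemma sightline_alone:
  assumes "c \<in> lines w"
  obtains z where "lines z = {c}"
proof -
  have "{c} \<subseteq> chords n" "noncrossing {c}"
    using assms by (auto simp: sightlines_def noncrossing_def crossing_def)
  then show thesis by (rule sightlines_weight_surj) (rule that)
qed

text \<open>
  Keeping only one of the sight lines gives a proper face that contains the facet; by dimension the two
  coincide.
\<close>

lemma facet_sightlines:
  assumes "max_face P w facet_of P"
  obtains c where "lines w = {c}"
proof -
  have "max_face P w \<noteq> P" using assms facet_of_irrefl by metis
  then obtain c where c: "c \<in> lines w" using max_face_eq_P_iff by blast
  then obtain z where z: "lines z = {c}" by (rule sightline_alone)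
  have sub: "max_face P w \<subseteq> max_face P z" using max_face_subset_iff z c by simp
  have "max_face P w = max_face P z"
  proof (rule ccontr)
    assume neq: "max_face P w \<noteq> max_face P z"
    have "max_face P w face_of max_face P z"
      using face_of_subset[OF max_face_face sub face_of_imp_subset[OF max_face_face]] .
    then have "aff_dim (max_face P w) < aff_dim (max_face P z)"
      using neq face_of_aff_dim_lt face_of_imp_convex[OF max_face_face] by blast
    moreover have "aff_dim (max_face P z) < aff_dim P"
      using z max_face_eq_P_iff[of z]
      by (intro face_of_aff_dim_lt max_face_face) (auto simp: polytope_imp_convex polytope_Ass_III)
    moreover have "aff_dim (max_face P w) = aff_dim P - 1" using assms by (simp add: facet_of_def)
    ultimately show False by simp
  qed
  then show thesis using that max_face_eq_iff z by simp
qed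

text \<open>
  The face lies in some facet, whose single sight line is then also \<open>c\<close>.
\<close>

lemma facet_of_sightline:
  assumes "lines z = {c}"
  shows "max_face P z facet_of P"
proof -
  have "max_face P z \<noteq> P" using max_face_eq_P_iff assms by simp
  then obtain G where G: "G facet_of P" "max_face P z \<subseteq> G"
    using face_of_polyhedron_subset_facet
        [OF polytope_imp_polyhedron[OF polytope_Ass_III] max_face_face max_face_P_nonempty]
    by blast
  then have "G face_of P" "G \<noteq> {}" by (auto simp: facet_of_def)
  then obtain u where u: "G = max_face P u" by (rule nonempty_face_cases)
  then obtain d where "lines u = {d}" using G(1) facet_sightlines by blast
  moreover have "lines u \<subseteq> lines z" using G(2) u max_face_subset_iff by simp
  ultimately have "lines u = lines z" using assms by simp
  then have "max_face P z = G" using u max_face_eq_iff by blast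
  then show ?thesis using G(1) by simp
qed

text \<open>
  The facets through the vertex \<open>F_w\<close> are matched with the sight lines of \<open>w\<close>: the one belonging to
  \<open>c\<close> is the face whose only sight line is \<open>c\<close>.
\<close>

lemma simple_P: "simple_polytope P"
  unfolding simple_polytope_def
proof (intro conjI allI impI polytope_Ass_III)
  fix v assume "v extreme_point_of P"
  then have "{v} face_of P" by (simp add: face_of_singleton)
  then obtain w where w: "{v} = max_face P w" by (rule nonempty_face_cases) simp
  have "\<exists>z. lines z = {c}" if "c \<in> lines w" for c
    using sightline_alone[OF that] by blast
  then obtain z where z: "\<And>c. c \<in> lines w \<Longrightarrow> lines (z c) = {c}" by metis
  have "bij_betw (\<lambda>c. max_face P (z c)) (lines w) {F. F facet_of P \<and> v \<in> F}"
  proof (rule bij_betw_imageI)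
    show "inj_on (\<lambda>c. max_face P (z c)) (lines w)"
      by (rule inj_onI) (use max_face_eq_iff z in auto)
    show "(\<lambda>c. max_face P (z c)) ` lines w = {F. F facet_of P \<and> v \<in> F}"
    proof (intro equalityI subsetI)
      fix F assume "F \<in> (\<lambda>c. max_face P (z c)) ` lines w"
      then obtain c where c: "c \<in> lines w" "F = max_face P (z c)" by blast
      have "max_face P w \<subseteq> F" using c z max_face_subset_iff by simp
      then have "v \<in> F" using w by auto
      then show "F \<in> {F. F facet_of P \<and> v \<in> F}" using c z facet_of_sightline by auto
    next
      fix F assume "F \<in> {F. F facet_of P \<and> v \<in> F}"
      then have F: "F facet_of P" "v \<in> F" by auto
      then have "F face_of P" "F \<noteq> {}" by (auto simp: facet_of_def)
      then obtain u where u: "F = max_face P u" by (rule nonempty_face_cases)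
      then obtain c where c: "lines u = {c}" using F(1) facet_sightlines by blast
      have "max_face P w \<subseteq> max_face P u" using F(2) u w by auto
      then have "c \<in> lines w" using c max_face_subset_iff by auto
      moreover have "F = max_face P (z c)" using u c z[OF \<open>c \<in> lines w\<close>] max_face_eq_iff by simp
      ultimately show "F \<in> (\<lambda>c. max_face P (z c)) ` lines w" by blast
    qed
  qed
  then have "card {F. F facet_of P \<and> v \<in> F} = card (lines w)" by (simp add: bij_betw_same_card)
  then show "int (card {F. F facet_of P \<and> v \<in> F}) = aff_dim P"
    using card_sightlines_vertex[of w v] w aff_dim_P by simp
qed

text \<open>
  A nonempty face is the set of maximizers of many functions \<open>w\<close>; any choice gives the
  same subdivision, because the face determines the sight lines.
\<close>

lemma face_subdivision_iso:
  assumes gon: "convex_gon n p"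
  obtains \<phi> where "\<And>w. \<phi> (max_face P w) = Some (subdiv_of idx n p w)" "\<phi> {} = None"
    "poset_iso \<phi> (faces P) (\<subseteq>) (LAss n p) LAss_le"
proof
  define \<phi> where "\<phi> = (\<lambda>F. if F = {} then None
    else Some (subdiv_of idx n p (SOME w. max_face P w = F)))"
  show phi: "\<phi> (max_face P w) = Some (subdiv_of idx n p w)" for w
  proof -
    have "max_face P (SOME v. max_face P v = max_face P w) = max_face P w"
      by (rule someI) simp
    then show ?thesis by (simp add: \<phi>_def max_face_P_nonempty subdiv_of_eq[OF gon] max_face_eq_iff)
  qed
  show empty: "\<phi> {} = None" by (simp add: \<phi>_def)
  have faces: "faces P = insert {} (range (max_face P))"
    using nonempty_faces_eq_max_faces[OF polytope_Ass_III P_nonempty] by (auto simp: faces_def)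
  have sub: "subdiv_of idx n p v \<subseteq> subdiv_of idx n p w \<longleftrightarrow> max_face P w \<subseteq> max_face P v" for v w
    unfolding subdiv_of_eq[OF gon] max_face_subset_iff
    by (rule inj_on_image_subset_iff[OF inj_on_chord_segment[OF gon]])
       (auto simp: sightlines_def)
  have order: "F \<subseteq> G \<longleftrightarrow> LAss_le (\<phi> F) (\<phi> G)" if "F \<in> faces P" "G \<in> faces P" for F G
    using that max_face_P_nonempty unfolding faces by (auto simp: phi empty sub)
  have "inj_on \<phi> (faces P)"
  proof (rule inj_onI)
    fix F G assume FG: "F \<in> faces P" "G \<in> faces P" "\<phi> F = \<phi> G"
    have refl: "LAss_le X X" for X :: "(real ^ 2) set set option" by (cases X) auto
    show "F = G" using order[of F G] order[of G F] FG refl[of "\<phi> G"] by auto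
  qed
  moreover have "range (subdiv_of idx n p) = subdivisions n p"
  proof (intro equalityI subsetI)
    fix S assume "S \<in> range (subdiv_of idx n p)"
    then show "S \<in> subdivisions n p"
      using noncrossing_sightlines[of n]
      by (auto simp: subdivisions_eq[OF gon] subdiv_of_eq[OF gon] sightlines_def)
  next
    fix S assume "S \<in> subdivisions n p"
    then obtain T where T: "T \<subseteq> chords n" "noncrossing T" "S = chord_segment p ` T"
      by (auto simp: subdivisions_eq[OF gon])
    obtain w where "lines w = T" using sightlines_weight_surj[OF T(1,2)] .
    then have "S = subdiv_of idx n p w" by (simp add: T subdiv_of_eq[OF gon])
    then show "S \<in> range (subdiv_of idx n p)" by blast
  qed
  then have "\<phi> ` faces P = LAss n p"
    unfolding faces LAss_def by (simp add: phi empty image_image flip: \<open>_ = subdivisions n p\<close>)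
  ultimately show "poset_iso \<phi> (faces P) (\<subseteq>) (LAss n p) LAss_le"
    using order by (auto simp: poset_iso_def bij_betw_def)
qed

end

theorem theorem2p15:
  fixes n :: nat
    and idx :: "nat \<Rightarrow> 'd::finite"
    and a :: "nat \<Rightarrow> nat \<Rightarrow> real"
    and p :: "nat \<Rightarrow> real ^ 2"
  assumes "n \<ge> 1"
    and "bij_betw idx {1..n + 1} UNIV"
    and "\<And>i j. 1 \<le> i \<Longrightarrow> i \<le> j \<Longrightarrow> j \<le> n + 1 \<Longrightarrow> a i j > 0"
    and "convex_gon n p"
  shows "(\<exists>\<phi>.
            {F \<in> faces (Ass_III idx n a). F \<noteq> {}} = range (max_face (Ass_III idx n a)) \<and>
            (\<forall>w. \<phi> (max_face (Ass_III idx n a) w) = Some (subdiv_of idx n p w)) \<and>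
            \<phi> {} = None \<and>
            poset_iso \<phi> (faces (Ass_III idx n a)) (\<subseteq>) (LAss n p) LAss_le)
       \<and> associahedron n (Ass_III idx n a)"
proof -
  interpret ass_III n idx a using assms(2,3) by unfold_locales
  obtain \<phi> where \<phi>: "\<And>w. \<phi> (max_face P w) = Some (subdiv_of idx n p w)" "\<phi> {} = None"
      "poset_iso \<phi> (faces P) (\<subseteq>) (LAss n p) LAss_le"
    using face_subdivision_iso[OF assms(4)] by metis
  have "associahedron n P"
    unfolding associahedron_def using simple_P aff_dim_P assms(4) \<phi>(3) by blast
  moreover have "{F \<in> faces P. F \<noteq> {}} = range (max_face P)"
    using polytope_Ass_III P_nonempty by (rule nonempty_faces_eq_max_faces)
  ultimately show ?thesis using \<phi> by blast
qed

end
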